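(* Assume Martin's Axiom. Then for every integer $n>1$ there is a level 2 Borel function $F:(2^\omega)^n\to2^\omega$ which is universal, i.e., for every $G:(2^\omega)^n\to2^\omega$ there exist $h_i:2^\omega\to2^\omega$ ($1\le i\le n$) such that for every $(x_1,\ldots,x_n)\in(2^\omega)^n$ $$G(x_1,\ldots,x_n)=F(h_1(x_1),\ldots,h_n(x_n)).$$
   Context: A function $F:(2^\omega)^n\to2^\omega$ is level 2 iff for every $k<\omega$ the set $\{\vec x\in(2^\omega)^n:F(\vec x)(k)=1\}$ is $\mathbf\Sigma^0_2$ (i.e. $F_\sigma$). *)

theory Defs
  imports "HOL-Analysis.Analysis" "HOL-Library.Equipollence"
begin

section \<open>Martin's Axiom\<close>

definition compatible :: "'a rel \<Rightarrow> 'a \<Rightarrow> 'a \<Rightarrow> bool" where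
  "compatible r p q \<longleftrightarrow> (\<exists>s. (s, p) \<in> r \<and> (s, q) \<in> r)"

definition ccc :: "'a set \<Rightarrow> 'a rel \<Rightarrow> bool" where
  "ccc P r \<longleftrightarrow> (\<forall>A\<subseteq>P. (\<forall>p\<in>A. \<forall>q\<in>A. p \<noteq> q \<longrightarrow> \<not> compatible r p q) \<longrightarrow> countable A)"

definition order_dense :: "'a set \<Rightarrow> 'a rel \<Rightarrow> 'a set \<Rightarrow> bool" where
  "order_dense P r D \<longleftrightarrow> D \<subseteq> P \<and> (\<forall>p\<in>P. \<exists>d\<in>D. (d, p) \<in> r)"

definition order_filter :: "'a set \<Rightarrow> 'a rel \<Rightarrow> 'a set \<Rightarrow> bool" where
  "order_filter P r G \<longleftrightarrow> G \<subseteq> P \<and> G \<noteq> {}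
     \<and> (\<forall>p\<in>G. \<forall>q\<in>P. (p, q) \<in> r \<longrightarrow> q \<in> G)
     \<and> (\<forall>p\<in>G. \<forall>q\<in>G. \<exists>s\<in>G. (s, p) \<in> r \<and> (s, q) \<in> r)"

text \<open>
  Martin's Axiom for the partial orders whose elements are taken from a given type.  A pair
  \<open>(p, q) \<in> r\<close> reads ``\<open>p\<close> is below (stronger than) \<open>q\<close>''.
\<close>

definition MA_on :: "'a itself \<Rightarrow> bool" where
  "MA_on _ \<longleftrightarrow> (\<forall>(P :: 'a set) r \<D>.
     P \<noteq> {} \<longrightarrow> partial_order_on P r \<longrightarrow> ccc P r \<longrightarrow>
     (\<forall>D\<in>\<D>. order_dense P r D) \<longrightarrow> \<D> \<prec> (UNIV :: (nat \<Rightarrow> bool) set) \<longrightarrow>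
     (\<exists>G. order_filter P r G \<and> (\<forall>D\<in>\<D>. G \<inter> D \<noteq> {})))"

text \<open>
  A hypothesis in HOL cannot quantify over all types, so Martin's Axiom is stated for the partial
  orders living on a set of size continuum.  Nothing is lost: \<open>Martins_Axiom_imp_MA_on\<close>
  below derives from it the instance for every type.
\<close>

definition Martins_Axiom :: bool where
  "Martins_Axiom \<longleftrightarrow> MA_on TYPE(nat \<Rightarrow> bool)"

context
  includes cardinal_syntax
begin

lemma lepoll_iff_card_of: "A \<lesssim> B \<longleftrightarrow> |A| \<le>o |B|"
  by (simp add: lepoll_def card_of_ordLeq)

lemma lepoll_Un_infinite:
  assumes "infinite C" "A \<lesssim> C" "B \<lesssim> C"
  shows "A \<union> B \<lesssim> C"
  using card_of_Un_ordLeq_infinite_Field[of "|C|" A B] assms card_of_Card_order[of C]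
  unfolding lepoll_iff_card_of Field_card_of by blast

lemma lepoll_Times_infinite:
  assumes "infinite C" "A \<lesssim> C" "B \<lesssim> C"
  shows "A \<times> B \<lesssim> C"
  using card_of_Times_ordLeq_infinite_Field[of "|C|" A B] assms card_of_Card_order[of C]
  unfolding lepoll_iff_card_of Field_card_of by blast

lemma lepoll_UN_nat_infinite:
  fixes A :: "nat \<Rightarrow> 'a set"
  assumes "infinite C" "\<And>i. A i \<lesssim> C"
  shows "(\<Union>i. A i) \<lesssim> C"
  unfolding lepoll_iff_card_of
  by (rule card_of_UNION_ordLeq_infinite)
    (use assms in \<open>auto simp flip: lepoll_iff_card_of infinite_le_lepoll\<close>)

end

lemma closure_lepoll:
  fixes f :: "'a \<Rightarrow> 'b \<Rightarrow> 'a" and g :: "'a \<Rightarrow> 'a \<Rightarrow> 'a"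
  assumes "infinite C" "I \<lesssim> C" "p0 \<in> P"
    and f: "\<And>p i. p \<in> P \<Longrightarrow> i \<in> I \<Longrightarrow> f p i \<in> P"
    and g: "\<And>p q. p \<in> P \<Longrightarrow> q \<in> P \<Longrightarrow> g p q \<in> P"
  obtains Q where "Q \<subseteq> P" "p0 \<in> Q" "Q \<lesssim> C"
    "\<And>p i. p \<in> Q \<Longrightarrow> i \<in> I \<Longrightarrow> f p i \<in> Q" "\<And>p q. p \<in> Q \<Longrightarrow> q \<in> Q \<Longrightarrow> g p q \<in> Q"
proof -
  define S where "S = rec_nat {p0}
    (\<lambda>_ X. X \<union> (case_prod f ` (X \<times> I) \<union> case_prod g ` (X \<times> X)))"
  have S0: "S 0 = {p0}"
    and SS: "S (Suc n) = S n \<union> (case_prod f ` (S n \<times> I) \<union> case_prod g ` (S n \<times> S n))" for n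
    by (simp_all add: S_def)
  have mono: "S m \<subseteq> S n" if "m \<le> n" for m n
    using that by (rule lift_Suc_mono_le[rotated]) (auto simp: SS)
  have sub: "S n \<subseteq> P" for n
    by (induction n) (use assms(3) f g in \<open>auto simp: S0 SS subset_iff\<close>)
  have small: "S n \<lesssim> C" for n
  proof (induction n)
    case 0
    have "C \<noteq> {}" using assms(1) by auto
    then show ?case by (auto simp: S0 lepoll_def)
  next
    case (Suc n)
    then show ?case unfolding SS
      by (intro lepoll_Un_infinite lepoll_trans[OF image_lepoll] lepoll_Times_infinite assms(1,2))
  qed
  show ?thesis
  proof (rule that[of "\<Union>n. S n"])
    show "(\<Union>n. S n) \<subseteq> P" using sub by blast
    show "p0 \<in> (\<Union>n. S n)" using S0 by blast
    show "(\<Union>n. S n) \<lesssim> C" by (rule lepoll_UN_nat_infinite) (use assms(1) small in auto)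
    show "f p i \<in> (\<Union>n. S n)" if p: "p \<in> (\<Union>n. S n)" and i: "i \<in> I" for p i
    proof -
      from p obtain n where "p \<in> S n" by blast
      then have "f p i \<in> S (Suc n)" using i unfolding SS by force
      then show ?thesis by blast
    qed
    show "g p q \<in> (\<Union>n. S n)" if p: "p \<in> (\<Union>n. S n)" and q: "q \<in> (\<Union>n. S n)" for p q
    proof -
      from p q obtain m n where "p \<in> S m" "q \<in> S n" by blast
      then have "p \<in> S (max m n)" "q \<in> S (max m n)"
        using mono[of m "max m n"] mono[of n "max m n"] by auto
      then have "g p q \<in> S (Suc (max m n))" unfolding SS by force
      then show ?thesis by blast
    qed
  qed
qed

lemma Martins_Axiom_imp_MA_on:
  assumes "Martins_Axiom"
  shows "MA_on TYPE('a)"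
  unfolding MA_on_def
proof (intro allI impI)
  fix P :: "'a set" and r and \<D>
  assume ne: "P \<noteq> {}" and po: "partial_order_on P r" and ccc: "ccc P r"
    and dense: "\<forall>D\<in>\<D>. order_dense P r D" and small: "\<D> \<prec> (UNIV :: (nat \<Rightarrow> bool) set)"
  note poD = partial_order_onD[OF po]
  have refl: "(p, p) \<in> r" if "p \<in> P" for p using poD(1) that by (auto simp: refl_on_def)
  have trans: "(p, q) \<in> r \<Longrightarrow> (q, s) \<in> r \<Longrightarrow> (p, s) \<in> r" for p q s
    using poD(2) by (auto dest: transD)
  have antisym: "(p, q) \<in> r \<Longrightarrow> (q, p) \<in> r \<Longrightarrow> p = q" for p q
    using poD(3) by (auto dest: antisymD)
  have field: "p \<in> P" "q \<in> P" if "(p, q) \<in> r" for p q using poD(4) that by auto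
  define f where "f = (\<lambda>p D. SOME d. d \<in> D \<and> (d, p) \<in> r)"
  define g where "g = (\<lambda>p q. if compatible r p q then SOME s. (s, p) \<in> r \<and> (s, q) \<in> r else p)"
  have f: "f p D \<in> D \<and> (f p D, p) \<in> r" if "p \<in> P" "D \<in> \<D>" for p D
    unfolding f_def by (rule someI_ex) (use dense that in \<open>unfold order_dense_def, blast\<close>)
  have g: "(g p q, p) \<in> r \<and> (g p q, q) \<in> r" if "compatible r p q" for p q
  proof -
    have "\<exists>s. (s, p) \<in> r \<and> (s, q) \<in> r" using that by (simp add: compatible_def)
    from someI_ex[OF this] show ?thesis using that by (simp add: g_def)
  qed
  obtain p0 where "p0 \<in> P" using ne by blast
  have "(UNIV :: nat set) \<lesssim> (UNIV :: (nat \<Rightarrow> bool) set)"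
    unfolding lepoll_def by (rule exI[of _ "\<lambda>n i. i = n"]) (auto simp: inj_on_def fun_eq_iff)
  then have inf: "infinite (UNIV :: (nat \<Rightarrow> bool) set)"
    by (simp add: infinite_le_lepoll)
  obtain Q where Q: "Q \<subseteq> P" "p0 \<in> Q" "Q \<lesssim> (UNIV :: (nat \<Rightarrow> bool) set)"
    and Qf: "\<And>p D. p \<in> Q \<Longrightarrow> D \<in> \<D> \<Longrightarrow> f p D \<in> Q"
    and Qg: "\<And>p q. p \<in> Q \<Longrightarrow> q \<in> Q \<Longrightarrow> g p q \<in> Q"
  proof (rule closure_lepoll[OF inf lesspoll_imp_lepoll[OF small] \<open>p0 \<in> P\<close>, of f g])
    show "f p D \<in> P" if "p \<in> P" "D \<in> \<D>" for p D using f[OF that] field by blast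
    show "g p q \<in> P" if "p \<in> P" "q \<in> P" for p q
    proof (cases "compatible r p q")
      case True then show ?thesis using g[OF True] field by blast
    qed (simp add: g_def that)
  qed blast
  obtain e :: "'a \<Rightarrow> nat \<Rightarrow> bool" where e: "inj_on e Q" using Q(3) by (auto simp: lepoll_def)
  have e_eq: "e p = e q \<longleftrightarrow> p = q" if "p \<in> Q" "q \<in> Q" for p q
    using e that by (auto dest: inj_onD)
  define r' where "r' = map_prod e e ` (r \<inter> Q \<times> Q)"
  have r'_iff: "(e p, e q) \<in> r' \<longleftrightarrow> (p, q) \<in> r" if "p \<in> Q" "q \<in> Q" for p q
    using that by (auto simp: r'_def e_eq image_iff map_prod_def intro!: bexI[of _ "(p, q)"])
  have r'_cases: "\<exists>p\<in>Q. \<exists>q\<in>Q. a = e p \<and> b = e q \<and> (p, q) \<in> r" if "(a, b) \<in> r'" for a b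
    using that by (auto simp: r'_def)
  have compat: "compatible r' (e p) (e q)" if "p \<in> Q" "q \<in> Q" "compatible r p q" for p q
    unfolding compatible_def
    by (rule exI[of _ "e (g p q)"]) (use g[OF that(3)] that Qg r'_iff in auto)
  have po': "partial_order_on (e ` Q) r'"
    unfolding partial_order_on_def preorder_on_def
  proof (intro conjI)
    show "r' \<subseteq> e ` Q \<times> e ` Q" by (auto simp: r'_def)
    show "refl_on (e ` Q) r'" using Q(1) refl r'_iff by (auto simp: refl_on_def)
    show "trans r'"
    proof (rule transI)
      fix a b c assume "(a, b) \<in> r'" "(b, c) \<in> r'"
      then show "(a, c) \<in> r'" by (metis r'_cases r'_iff e_eq trans)
    qed
    show "antisym r'"
    proof (rule antisymI)
      fix a b assume "(a, b) \<in> r'" "(b, a) \<in> r'"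
      then show "a = b" by (metis r'_cases e_eq antisym)
    qed
  qed
  have ccc': "ccc (e ` Q) r'"
    unfolding ccc_def
  proof (intro allI impI)
    fix A assume A: "A \<subseteq> e ` Q" and anti: "\<forall>p\<in>A. \<forall>q\<in>A. p \<noteq> q \<longrightarrow> \<not> compatible r' p q"
    from A obtain B where B: "B \<subseteq> Q" "A = e ` B" by (meson subset_image_iff)
    have anti_B: "\<not> compatible r p q" if "p \<in> B" "q \<in> B" "p \<noteq> q" for p q
    proof -
      have "p \<in> Q" "q \<in> Q" "e p \<in> A" "e q \<in> A" using that B by auto
      then show ?thesis using anti compat[of p q] e_eq[of p q] that(3) by metis
    qed
    have "B \<subseteq> P" using B(1) Q(1) by simp
    with ccc anti_B have "countable B" by (simp add: ccc_def)
    then show "countable A" using B(2) by simp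
  qed
  define \<D>' where "\<D>' = (\<lambda>D. e ` (D \<inter> Q)) ` \<D>"
  have dense': "\<forall>D\<in>\<D>'. order_dense (e ` Q) r' D"
  proof
    fix D' assume "D' \<in> \<D>'"
    then obtain D where D: "D \<in> \<D>" "D' = e ` (D \<inter> Q)" by (auto simp: \<D>'_def)
    have "\<exists>d\<in>D'. (d, e p) \<in> r'" if "p \<in> Q" for p
    proof (rule bexI[of _ "e (f p D)"])
      have "f p D \<in> D" "(f p D, p) \<in> r" "f p D \<in> Q" using f Qf Q(1) D(1) that by auto
      then show "(e (f p D), e p) \<in> r'" "e (f p D) \<in> D'" using D(2) that r'_iff by auto
    qed
    then show "order_dense (e ` Q) r' D'" using D(2) by (auto simp: order_dense_def)
  qed
  have small': "\<D>' \<prec> (UNIV :: (nat \<Rightarrow> bool) set)"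
    unfolding \<D>'_def by (rule lesspoll_trans1[OF image_lepoll small])
  have "e ` Q \<noteq> {}" using Q(2) by auto
  with assms po' ccc' dense' small'
  obtain G' where G': "order_filter (e ` Q) r' G'" "\<forall>D\<in>\<D>'. G' \<inter> D \<noteq> {}"
    unfolding Martins_Axiom_def MA_on_def by meson
  define G where "G = {p \<in> P. \<exists>q\<in>Q. e q \<in> G' \<and> (q, p) \<in> r}"
  have in_G: "q \<in> G" if "q \<in> Q" "e q \<in> G'" for q
    using that Q(1) refl by (auto simp: G_def)
  have "order_filter P r G"
    unfolding order_filter_def
  proof (intro conjI ballI impI)
    show "G \<subseteq> P" by (auto simp: G_def)
    from G'(1) obtain a where a: "a \<in> G'" "G' \<subseteq> e ` Q" by (auto simp: order_filter_def)
    then obtain q where "q \<in> Q" "a = e q" by blast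
    then show "G \<noteq> {}" using in_G a by blast
    show "q \<in> G" if "p \<in> G" "q \<in> P" "(p, q) \<in> r" for p q
      using that trans unfolding G_def by blast
    fix p q assume "p \<in> G" "q \<in> G"
    then obtain p' q' where pq: "p' \<in> Q" "e p' \<in> G'" "(p', p) \<in> r" "q' \<in> Q" "e q' \<in> G'" "(q', q) \<in> r"
      by (auto simp: G_def)
    then obtain c where c: "c \<in> G'" "(c, e p') \<in> r'" "(c, e q') \<in> r'"
      using G'(1) unfolding order_filter_def by meson
    then obtain s where s: "s \<in> Q" "c = e s" using a(2) by blast
    then have "(s, p') \<in> r" "(s, q') \<in> r" using c pq r'_iff by auto
    then have "(s, p) \<in> r" "(s, q) \<in> r" using pq trans by blast+
    moreover have "s \<in> G" using in_G c s by blast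
    ultimately show "\<exists>s\<in>G. (s, p) \<in> r \<and> (s, q) \<in> r" by blast
  qed
  moreover have "G \<inter> D \<noteq> {}" if "D \<in> \<D>" for D
  proof -
    have "e ` (D \<inter> Q) \<in> \<D>'" using that by (auto simp: \<D>'_def)
    then have "G' \<inter> e ` (D \<inter> Q) \<noteq> {}" using G'(2) by simp
    then obtain d where "d \<in> D" "d \<in> Q" "e d \<in> G'" by auto
    then show ?thesis using in_G[of d] by auto
  qed
  ultimately show "\<exists>G. order_filter P r G \<and> (\<forall>D\<in>\<D>. G \<inter> D \<noteq> {})" by blast
qed


section \<open>Level 2 functions on powers of the Cantor space\<close>

text \<open>
  The type \<open>nat \<Rightarrow> bool\<close> carries the product of the discrete topologies in HOL-Analysis, so its
  \<open>euclidean\<close> topology is that of the Cantor space.  Points of its \<open>n\<close>-th power are the functions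
  on \<open>{1..n}\<close>, extended by \<open>undefined\<close> to the other natural numbers.
\<close>

instance bool :: second_countable_topology
proof
  show "\<exists>B :: bool set set. countable B \<and> open = generate_topology B"
    by (intro exI[of _ UNIV]) (auto simp: fun_eq_iff open_discrete intro: generate_topology.Basis)
qed

type_synonym cantor = "nat \<Rightarrow> bool"

definition cantor_power :: "nat \<Rightarrow> (nat \<Rightarrow> cantor) topology" where
  "cantor_power n = product_topology (\<lambda>_. euclidean) {1..n}"

lemma topspace_cantor_power: "topspace (cantor_power n) = {1..n} \<rightarrow>\<^sub>E UNIV"
  by (simp add: cantor_power_def)

definition borel_function :: "nat \<Rightarrow> ((nat \<Rightarrow> cantor) \<Rightarrow> cantor) \<Rightarrow> bool" where
  "borel_function n F \<longleftrightarrow>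
     F \<in> borel_measurable (sigma (topspace (cantor_power n)) {U. openin (cantor_power n) U})"

definition level2 :: "nat \<Rightarrow> ((nat \<Rightarrow> cantor) \<Rightarrow> cantor) \<Rightarrow> bool" where
  "level2 n F \<longleftrightarrow> (\<forall>k. fsigma_in (cantor_power n) {x \<in> topspace (cantor_power n). F x k})"

lemma level2_imp_borel_function:
  assumes "level2 n F"
  shows "borel_function n F"
  unfolding borel_function_def
proof (rule measurable_coordinatewise_then_product)
  fix k
  let ?X = "cantor_power n"
  let ?M = "sigma (topspace ?X) {U. openin ?X U}"
  have sub: "{U. openin ?X U} \<subseteq> Pow (topspace ?X)" by (auto dest: openin_subset)
  have space: "space ?M = topspace ?X" using sub by simp
  have open_M: "U \<in> sets ?M" if "openin ?X U" for U using sub that by simp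
  have closed_M: "S \<in> sets ?M" if "closedin ?X S" for S
  proof -
    have "topspace ?X - (topspace ?X - S) \<in> sets ?M"
      using open_M[of "topspace ?X - S"] sets.compl_sets[of _ ?M] that space
      by (metis closedin_def)
    then show ?thesis using closedin_subset[OF that] by (simp add: double_diff)
  qed
  have T: "{x \<in> topspace ?X. F x k} \<in> sets ?M"
  proof -
    have "fsigma_in ?X {x \<in> topspace ?X. F x k}" using assms by (simp add: level2_def)
    then obtain C :: "nat \<Rightarrow> (nat \<Rightarrow> cantor) set"
      where C: "\<And>m. closedin ?X (C m)" "(\<Union>m. C m) = {x \<in> topspace ?X. F x k}"
      by (auto simp: fsigma_in_ascending)
    have "(\<Union>m. C m) \<in> sets ?M" by (rule sets.countable_UN) (use C(1) closed_M in blast)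
    then show ?thesis by (simp only: C(2))
  qed
  then have "Measurable.pred ?M (\<lambda>x. F x k)"
    by (simp add: pred_def space)
  then show "(\<lambda>x. F x k) \<in> borel_measurable ?M"
    by (rule measurable_compose) simp
qed

definition universal :: "nat \<Rightarrow> ((nat \<Rightarrow> cantor) \<Rightarrow> cantor) \<Rightarrow> bool" where
  "universal n F \<longleftrightarrow> (\<forall>G :: (nat \<Rightarrow> cantor) \<Rightarrow> cantor. \<exists>h :: nat \<Rightarrow> cantor \<Rightarrow> cantor.
     \<forall>x\<in>topspace (cantor_power n). G x = F (\<lambda>i\<in>{1..n}. h i (x i)))"

end

theory Submission
  imports Defs
begin

text \<open>
  Enumerate the Cantor space in the order type of its cardinality, so that initial segments have
  size less than the continuum.  Under Martin's Axiom there are functions \<open>f\<^sub>\<alpha>\<close> strictly increasing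
  modulo finite along this order; hence \<open>\<beta> \<le> \<alpha>\<close> becomes the almost inclusion of the region below
  the graph of \<open>f\<^sub>\<beta>\<close> in that of \<open>f\<^sub>\<alpha>\<close>.  Moreover the tuples of elements \<open>\<le> \<alpha>\<close> give an almost disjoint
  family of size less than the continuum (the sets of codes of their finite restrictions), so a
  single set of naturals codes any prescribed subset of them, by Solovay's almost disjoint coding.
  One \<open>h\<close> serves for all coordinates: \<open>h \<alpha>\<close> records \<open>\<alpha>\<close>, the region of \<open>f\<^sub>\<alpha>\<close> and the coding sets.
  To evaluate \<open>F\<close>, find a coordinate whose region almost contains all the others and use its coding
  sets; every condition involved says that an open relation holds for only finitely many naturals.
\<close>

section \<open>Cardinalities below the continuum\<close>

context
  includes cardinal_syntax
begin

lemma lesspoll_iff_card_of: "A \<prec> B \<longleftrightarrow> |A| <o |B|"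
  unfolding lesspoll_def lepoll_iff_card_of eqpoll_iff_card_of_ordIso
  using ordLeq_iff_ordLess_or_ordIso not_ordLess_ordIso ordLess_imp_ordLeq by blast

lemma lesspoll_Un_infinite:
  assumes "infinite C" "A \<prec> C" "B \<prec> C"
  shows "A \<union> B \<prec> C"
  using assms card_of_Un_ordLess_infinite unfolding lesspoll_iff_card_of by blast

text \<open>When the disjoint sum of the factors is infinite it bounds their product, so the strict
  bound for sums carries over; otherwise the product is finite.\<close>

lemma lesspoll_Times_infinite:
  assumes "infinite C" "A \<prec> C" "B \<prec> C"
  shows "A \<times> B \<prec> C"
proof (cases "finite (A <+> B)")
  case True
  then show ?thesis using assms(1) by (intro finite_lesspoll_infinite) auto
next
  case False
  moreover have "A \<lesssim> A <+> B" "B \<lesssim> A <+> B"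
    unfolding lepoll_iff_card_of by (rule card_of_Plus1, rule card_of_Plus2)
  ultimately have "A \<times> B \<lesssim> A <+> B" by (rule lepoll_Times_infinite)
  moreover have "A <+> B \<prec> C"
    using assms card_of_Plus_ordLess_infinite unfolding lesspoll_iff_card_of by blast
  ultimately show ?thesis by (rule lesspoll_trans1)
qed

text \<open>The cardinal of a set, taken as a well-order, is an initial ordinal, so its proper
  initial segments are strictly smaller.\<close>

lemma exists_small_initial_segments:
  obtains r :: "'a rel" where "well_order_on UNIV r" "\<And>x. underS r x \<prec> (UNIV :: 'a set)"
proof (rule that)
  show "well_order_on UNIV |UNIV :: 'a set|" by (rule card_of_well_order_on)
  show "underS |UNIV :: 'a set| x \<prec> (UNIV :: 'a set)" for x
    unfolding lesspoll_iff_card_of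
    using card_of_underS[OF card_of_Card_order, of x "UNIV :: 'a set"]
    by (simp add: Field_card_of)
qed

end

lemma lesspoll_PiE:
  assumes "infinite C" "finite I" "\<And>i. i \<in> I \<Longrightarrow> A i \<prec> C"
  shows "Pi\<^sub>E I A \<prec> C"
  using assms(2,3)
proof (induction I rule: finite_induct)
  case empty
  then show ?case using assms(1) by (simp add: finite_lesspoll_infinite)
next
  case (insert i I)
  then have "A i \<times> Pi\<^sub>E I A \<prec> C" by (intro lesspoll_Times_infinite assms(1)) auto
  then show ?case unfolding PiE_insert_eq by (rule lesspoll_trans1[OF image_lepoll])
qed

lemma nat_lesspoll_cantor: "(UNIV :: nat set) \<prec> (UNIV :: cantor set)"
proof -
  have "(UNIV :: cantor set) \<approx> Pow (UNIV :: nat set)"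
    unfolding eqpoll_def
    by (rule exI, rule bij_betw_byWitness[where f = Collect and f' = "\<lambda>A n. n \<in> A"]) auto
  then show ?thesis using lesspoll_Pow_self lesspoll_eq_trans eqpoll_sym by blast
qed

lemma infinite_cantor: "infinite (UNIV :: cantor set)"
  using nat_lesspoll_cantor infinite_le_lepoll lesspoll_imp_lepoll by blast

lemma countable_lesspoll_cantor:
  assumes "countable A"
  shows "A \<prec> (UNIV :: cantor set)"
proof -
  have "A \<lesssim> (UNIV :: nat set)" using assms by (auto simp: countable_def lepoll_def)
  then show ?thesis using nat_lesspoll_cantor lesspoll_trans1 by blast
qed

section \<open>Consequences of Martin's Axiom\<close>

text \<open>A condition \<open>(s, \<F>)\<close> consists of a finite part \<open>s\<close> of the
  future \<open>D\<close> and a promise that no further point of a member of \<open>\<F>\<close>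
  enters \<open>D\<close>.\<close>

lemma Martins_Axiom_almost_disjoint_from:
  fixes \<A> \<C> :: "'a::countable set set"
  assumes "Martins_Axiom"
    and small: "\<A> \<prec> (UNIV :: cantor set)" "\<C> \<prec> (UNIV :: cantor set)"
    and inf: "\<And>c \<F>. c \<in> \<C> \<Longrightarrow> finite \<F> \<Longrightarrow> \<F> \<subseteq> \<A> \<Longrightarrow> infinite (c - \<Union>\<F>)"
  obtains D where "\<And>a. a \<in> \<A> \<Longrightarrow> finite (a \<inter> D)" "\<And>c. c \<in> \<C> \<Longrightarrow> infinite (c \<inter> D)"
proof -
  define P where "P = {(s :: 'a set, \<F>). finite s \<and> finite \<F> \<and> \<F> \<subseteq> \<A>}"
  define r where "r = {((s', \<F>'), (s, \<F>)). (s', \<F>') \<in> P \<and> (s, \<F>) \<in> P \<and>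
    s \<subseteq> s' \<and> \<F> \<subseteq> \<F>' \<and> (s' - s) \<inter> \<Union>\<F> = {}}"
  have r_iff: "((s', \<F>'), (s, \<F>)) \<in> r \<longleftrightarrow> (s', \<F>') \<in> P \<and> (s, \<F>) \<in> P \<and>
    s \<subseteq> s' \<and> \<F> \<subseteq> \<F>' \<and> (s' - s) \<inter> \<Union>\<F> = {}" for s' \<F>' s \<F>
    by (simp add: r_def)
  have "({}, {}) \<in> P" by (simp add: P_def)
  then have "P \<noteq> {}" by blast
  moreover have "partial_order_on P r"
    unfolding partial_order_on_def preorder_on_def
  proof (intro conjI)
    show "r \<subseteq> P \<times> P" by (auto simp: r_def)
    show "refl_on P r" by (auto simp: refl_on_def r_def)
    show "antisym r" by (auto simp: antisym_def r_def)
    show "trans r"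
    proof (rule transI, clarify)
      fix s1 \<F>1 s2 \<F>2 s3 \<F>3
      assume 12: "((s1, \<F>1), (s2, \<F>2)) \<in> r" and 23: "((s2, \<F>2), (s3, \<F>3)) \<in> r"
      then have "\<Union>\<F>3 \<subseteq> \<Union>\<F>2" "s1 - s3 \<subseteq> (s1 - s2) \<union> (s2 - s3)" by (auto simp: r_iff)
      with 12 23 have "(s1 - s3) \<inter> \<Union>\<F>3 = {}" unfolding r_iff by blast
      with 12 23 show "((s1, \<F>1), (s3, \<F>3)) \<in> r" unfolding r_iff by blast
    qed
  qed
  moreover have "ccc P r"
    unfolding ccc_def
  proof (intro allI impI)
    fix A assume A: "A \<subseteq> P" and anti: "\<forall>p\<in>A. \<forall>q\<in>A. p \<noteq> q \<longrightarrow> \<not> compatible r p q"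
    \<comment> \<open>Conditions with the same finite part are compatible: join their promises. An
      antichain thus injects into the countable collection of finite sets.\<close>
    have "inj_on fst A"
    proof (rule inj_onI)
      fix p q assume pq: "p \<in> A" "q \<in> A" "fst p = fst q"
      obtain s \<F> \<G> where eq: "p = (s, \<F>)" "q = (s, \<G>)" using pq(3) by (metis prod.collapse)
      have "p \<in> P" "q \<in> P" using pq A by auto
      then have "((s, \<F> \<union> \<G>), p) \<in> r \<and> ((s, \<F> \<union> \<G>), q) \<in> r"
        by (simp add: eq r_iff P_def)
      then show "p = q" using anti pq unfolding compatible_def by blast
    qed
    moreover have "fst ` A \<subseteq> {s. finite s}" using A by (auto simp: P_def)
    then have "countable (fst ` A)"
      by (rule countable_subset) (rule countable_Collect_finite)
    ultimately show "countable A" by (rule countable_image_inj_on[rotated])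
  qed
  \<comment> \<open>Meeting \<open>U a\<close> makes the promise about \<open>a\<close>; meeting
    \<open>V (c, n)\<close> forces at least \<open>n\<close> points of \<open>c\<close> into
    \<open>D\<close>.\<close>
  moreover define U where "U = (\<lambda>a. {(s, \<F>) \<in> P. a \<in> \<F>})"
  define V where "V = (\<lambda>(c, n). {(s, \<F>) \<in> P. n \<le> card (s \<inter> c)})"
  define \<D> where "\<D> = U ` \<A> \<union> V ` (\<C> \<times> UNIV)"
  have "\<forall>D\<in>\<D>. order_dense P r D"
  proof -
    have "order_dense P r (U a)" if "a \<in> \<A>" for a
      unfolding order_dense_def
    proof (intro conjI ballI)
      fix p assume "p \<in> P"
      then show "\<exists>d\<in>U a. (d, p) \<in> r"
        by (intro bexI[of _ "(fst p, insert a (snd p))"])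
          (use that in \<open>auto simp: U_def P_def r_def\<close>)
    qed (auto simp: U_def)
    moreover have "order_dense P r (V (c, n))" if c: "c \<in> \<C>" for c n
      unfolding order_dense_def
    proof (intro conjI ballI)
      fix p assume p: "p \<in> P"
      obtain s \<F> where sF: "p = (s, \<F>)" by (cases p)
      have fin: "finite s" "finite \<F>" "\<F> \<subseteq> \<A>" using p by (auto simp: sF P_def)
      \<comment> \<open>By \<open>inf\<close> there are \<open>n\<close> new points of
        \<open>c\<close> that break none of the promises made so far.\<close>
      obtain t where t: "finite t" "card t = n" "t \<subseteq> c - \<Union>\<F>"
        using infinite_arbitrarily_large[OF inf[OF c fin(2,3)]] by blast
      have "n \<le> card ((s \<union> t) \<inter> c)"
        unfolding t(2)[symmetric] by (rule card_mono) (use t fin in auto)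
      then show "\<exists>d\<in>V (c, n). (d, p) \<in> r"
        by (intro bexI[of _ "(s \<union> t, \<F>)"]) (use t fin in \<open>auto simp: V_def P_def r_iff sF\<close>)
    qed (auto simp: V_def)
    ultimately show ?thesis by (auto simp: \<D>_def)
  qed
  moreover have "\<D> \<prec> (UNIV :: cantor set)"
    unfolding \<D>_def
    by (intro lesspoll_Un_infinite lesspoll_trans1[OF image_lepoll] lesspoll_Times_infinite
        infinite_cantor small nat_lesspoll_cantor)
  ultimately obtain G where G: "order_filter P r G" "\<forall>D\<in>\<D>. G \<inter> D \<noteq> {}"
    using Martins_Axiom_imp_MA_on[OF assms(1), unfolded MA_on_def, rule_format, of P r \<D>]
    by blast
  have common: "\<exists>u\<in>G. (u, p) \<in> r \<and> (u, q) \<in> r" if "p \<in> G" "q \<in> G" for p q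
    using G(1) that unfolding order_filter_def by blast
  define D where "D = \<Union>(fst ` G)"
  show ?thesis
  proof (rule that)
    fix a assume "a \<in> \<A>"
    then have "G \<inter> U a \<noteq> {}" using G(2) by (auto simp: \<D>_def)
    then obtain s \<F> where sF: "(s, \<F>) \<in> G" "a \<in> \<F>" "finite s" by (auto simp: U_def P_def)
    \<comment> \<open>Any point of \<open>D\<close> lies in the finite part of some condition in
      \<open>G\<close>. A common extension of it and \<open>(s, \<F>)\<close> adds to
      \<open>s\<close> no point of \<open>a\<close>.\<close>
    have "a \<inter> D \<subseteq> s"
    proof
      fix x assume "x \<in> a \<inter> D"
      then obtain t \<G> where "(t, \<G>) \<in> G" "x \<in> t" "x \<in> a" by (force simp: D_def)
      moreover obtain u \<H> where "((u, \<H>), (t, \<G>)) \<in> r" "((u, \<H>), (s, \<F>)) \<in> r"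
        using common[OF \<open>(t, \<G>) \<in> G\<close> sF(1)] by auto
      ultimately show "x \<in> s" using sF(2) unfolding r_iff by blast
    qed
    then show "finite (a \<inter> D)" using sF(3) finite_subset by blast
  next
    fix c assume c: "c \<in> \<C>"
    show "infinite (c \<inter> D)"
    proof
      assume fin: "finite (c \<inter> D)"
      have "V (c, Suc (card (c \<inter> D))) \<in> \<D>" using c by (auto simp: \<D>_def)
      then have "G \<inter> V (c, Suc (card (c \<inter> D))) \<noteq> {}" using G(2) by blast
      then obtain s \<F> where "(s, \<F>) \<in> G" "Suc (card (c \<inter> D)) \<le> card (s \<inter> c)"
        by (auto simp: V_def)
      moreover from this have "card (s \<inter> c) \<le> card (c \<inter> D)"
        by (intro card_mono[OF fin]) (force simp: D_def)
      ultimately show False by simp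
    qed
  qed
qed

text \<open>This turns pairwise almost disjointness into the hypothesis \<open>inf\<close> of the
  forcing lemma: finitely many finite traces cannot exhaust an infinite set.\<close>

lemma infinite_Diff_Union:
  assumes "finite \<F>" "\<And>a. a \<in> \<F> \<Longrightarrow> finite (c \<inter> a)" "infinite c"
  shows "infinite (c - \<Union>\<F>)"
proof
  assume "finite (c - \<Union>\<F>)"
  moreover have "finite (\<Union>a\<in>\<F>. c \<inter> a)" using assms(1,2) by blast
  ultimately have "finite ((c - \<Union>\<F>) \<union> (\<Union>a\<in>\<F>. c \<inter> a))" by blast
  moreover have "(c - \<Union>\<F>) \<union> (\<Union>a\<in>\<F>. c \<inter> a) = c" by blast
  ultimately show False using assms(3) by metis
qed

section \<open>Dominating functions and scales\<close>

text \<open>Take \<open>D\<close> almost disjoint from each region under a graph of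
  \<open>\<F>\<close> but meeting every vertical line, and let \<open>g\<close> pick one point of
  \<open>D\<close> per line. Where \<open>g n \<le> f n\<close>, that point lies in the finite set
  \<open>below f \<inter> D\<close>.\<close>

lemma Martins_Axiom_dominating:
  fixes \<F> :: "(nat \<Rightarrow> nat) set"
  assumes "Martins_Axiom" "\<F> \<prec> (UNIV :: cantor set)"
  obtains g where "\<And>f. f \<in> \<F> \<Longrightarrow> finite {n. g n \<le> f n}"
proof -
  define below where "below = (\<lambda>f :: nat \<Rightarrow> nat. {(n, m). m \<le> f n})"
  define \<C> where "\<C> = range (\<lambda>n :: nat. {n} \<times> (UNIV :: nat set))"
  obtain D where D: "\<And>a. a \<in> below ` \<F> \<Longrightarrow> finite (a \<inter> D)" "\<And>c. c \<in> \<C> \<Longrightarrow> infinite (c \<inter> D)"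
  proof (rule Martins_Axiom_almost_disjoint_from[OF assms(1)])
    show "below ` \<F> \<prec> (UNIV :: cantor set)" by (rule lesspoll_trans1[OF image_lepoll assms(2)])
    show "\<C> \<prec> (UNIV :: cantor set)" unfolding \<C>_def by (rule countable_lesspoll_cantor) simp
    fix c \<G> assume c: "c \<in> \<C>" and \<G>: "finite \<G>" "\<G> \<subseteq> below ` \<F>"
    obtain n where n: "c = {n} \<times> UNIV" using c by (auto simp: \<C>_def)
    have "finite (c \<inter> a)" if a: "a \<in> \<G>" for a
    proof -
      obtain f where "a = below f" using \<G>(2) a by blast
      then have "c \<inter> a = Pair n ` {..f n}" by (auto simp: n below_def)
      then show ?thesis by simp
    qed
    moreover have "infinite c" by (auto simp: n dest: finite_cartesian_productD2)
    ultimately show "infinite (c - \<Union>\<G>)" using \<G>(1) by (intro infinite_Diff_Union)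
  qed blast
  have "\<exists>m. (n, m) \<in> D" for n
  proof -
    have "{n} \<times> UNIV \<inter> D \<noteq> {}" using D(2)[of "{n} \<times> UNIV"] by (force simp: \<C>_def)
    then show ?thesis by blast
  qed
  then obtain g where g: "\<And>n. (n, g n) \<in> D" by metis
  show ?thesis
  proof (rule that)
    fix f assume "f \<in> \<F>"
    then have "finite (fst ` (below f \<inter> D))" using D(1) by blast
    moreover have "{n. g n \<le> f n} \<subseteq> fst ` (below f \<inter> D)"
      using g by (force simp: below_def)
    ultimately show "finite {n. g n \<le> f n}" using finite_subset by blast
  qed
qed

text \<open>Well-founded recursion: the function at \<open>x\<close> dominates the fewer than
  continuum many functions already chosen at its predecessors.\<close>

lemma Martins_Axiom_scale:
  fixes r :: "'a rel"
  assumes "Martins_Axiom" "wf (r - Id)" "\<And>x. underS r x \<prec> (UNIV :: cantor set)"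
  obtains f :: "'a \<Rightarrow> nat \<Rightarrow> nat"
  where "\<And>x y. y \<in> underS r x \<Longrightarrow> finite {n. f x n \<le> f y n}"
proof -
  have "\<exists>f :: 'a \<Rightarrow> nat \<Rightarrow> nat. \<forall>x. \<forall>y\<in>underS r x. finite {n. f x n \<le> f y n}"
  proof (rule dependent_wf_choice[OF assms(2)])
    fix x and f :: "'a \<Rightarrow> nat \<Rightarrow> nat"
    have "f ` underS r x \<prec> (UNIV :: cantor set)"
      by (rule lesspoll_trans1[OF image_lepoll assms(3)])
    then show "\<exists>g. \<forall>y\<in>underS r x. finite {n. g n \<le> f y n}"
      by (rule Martins_Axiom_dominating[OF assms(1)]) blast
  qed (auto simp: underS_def)
  then show ?thesis using that by blast
qed

section \<open>From scales to almost inclusion\<close>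

definition below_graph :: "(nat \<Rightarrow> nat) \<Rightarrow> cantor" where
  "below_graph f k \<longleftrightarrow> snd (prod_decode k) \<le> f (fst (prod_decode k))"

lemma below_graph_prod_encode [simp]: "below_graph f (prod_encode (n, m)) \<longleftrightarrow> m \<le> f n"
  by (simp add: below_graph_def)

text \<open>Over a given \<open>n\<close> the difference of the regions is always finite, and it is
  nonempty, containing the point at height \<open>f n\<close>, exactly when
  \<open>g n < f n\<close>.\<close>

lemma finite_below_graph_diff_iff:
  "finite {k. below_graph f k \<and> \<not> below_graph g k} \<longleftrightarrow> finite {n. g n < f n}"
proof
  assume "finite {k. below_graph f k \<and> \<not> below_graph g k}"
  moreover have "(\<lambda>n. prod_encode (n, f n)) ` {n. g n < f n} \<subseteq> {k. below_graph f k \<and> \<not> below_graph g k}"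
    by auto
  ultimately have "finite ((\<lambda>n. prod_encode (n, f n)) ` {n. g n < f n})"
    using finite_subset by blast
  then show "finite {n. g n < f n}" by (rule finite_imageD) (auto simp: inj_on_def)
next
  assume "finite {n. g n < f n}"
  then have "finite (prod_encode ` (SIGMA n:{n. g n < f n}. {..f n}))" by simp
  moreover have "{k. below_graph f k \<and> \<not> below_graph g k}
      \<subseteq> prod_encode ` (SIGMA n:{n. g n < f n}. {..f n})"
  proof
    fix k assume "k \<in> {k. below_graph f k \<and> \<not> below_graph g k}"
    then show "k \<in> prod_encode ` (SIGMA n:{n. g n < f n}. {..f n})"
      by (cases "prod_decode k", intro image_eqI[of _ _ "prod_decode k"])
        (auto simp: below_graph_def dest: arg_cong[of _ _ prod_encode])
  qed
  ultimately show "finite {k. below_graph f k \<and> \<not> below_graph g k}" using finite_subset by blast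
qed

lemma Martins_Axiom_tower:
  assumes "Martins_Axiom" "well_order_on UNIV r" "\<And>x. underS r x \<prec> (UNIV :: cantor set)"
  obtains T :: "'a \<Rightarrow> cantor"
  where "\<And>x y. finite {k. T y k \<and> \<not> T x k} \<longleftrightarrow> (y, x) \<in> r"
proof -
  from assms(2) have lin: "linear_order_on UNIV r" and wf: "wf (r - Id)"
    by (auto simp: well_order_on_def)
  have refl: "(x, x) \<in> r" and total: "x = y \<or> (x, y) \<in> r \<or> (y, x) \<in> r"
    and antisym: "(x, y) \<in> r \<Longrightarrow> (y, x) \<in> r \<Longrightarrow> x = y" for x y
    using lin by (auto simp: order_on_defs refl_on_def total_on_def dest: antisymD)
  obtain f :: "'a \<Rightarrow> nat \<Rightarrow> nat"
    where f: "\<And>x y. y \<in> underS r x \<Longrightarrow> finite {n. f x n \<le> f y n}"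
    using Martins_Axiom_scale[OF assms(1) wf assms(3)] by blast
  have "finite {n. f x n < f y n} \<longleftrightarrow> (y, x) \<in> r" for x y
  proof
    assume fin: "finite {n. f x n < f y n}"
    show "(y, x) \<in> r"
    proof (rule ccontr)
      assume "(y, x) \<notin> r"
      then have "x \<in> underS r y" using refl[of x] total[of x y] by (auto simp: underS_def)
      \<comment> \<open>If \<open>y\<close> is not below \<open>x\<close>, then \<open>x\<close>
        strictly precedes \<open>y\<close> and the scale makes the complementary set finite as well,
        so two finite sets would cover the naturals.\<close>
      then have "finite ({n. f x n < f y n} \<union> {n. f y n \<le> f x n})" using f fin by simp
      moreover have "{n. f x n < f y n} \<union> {n. f y n \<le> f x n} = UNIV" by auto
      ultimately show False by simp
    qed
  next
    assume "(y, x) \<in> r"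
    show "finite {n. f x n < f y n}"
    proof (cases "x = y")
      case False
      with \<open>(y, x) \<in> r\<close> have "finite {n. f x n \<le> f y n}" by (intro f) (auto simp: underS_def)
      then show ?thesis by (rule rev_finite_subset) auto
    qed simp
  qed
  then show ?thesis by (intro that[of "\<lambda>x. below_graph (f x)"]) (simp add: finite_below_graph_diff_iff)
qed

section \<open>Coding sets of tuples\<close>

text \<open>For fixed \<open>p\<close> the codes form a branch of a tree whose level
  \<open>m\<close> consists of the \<open>n\<close>-tuples of binary strings of length
  \<open>m\<close>.\<close>

definition prefix_code :: "nat \<Rightarrow> (nat \<Rightarrow> cantor) \<Rightarrow> nat \<Rightarrow> nat" where
  "prefix_code n p m = to_nat (map (\<lambda>i. map (p i) [0..<m]) [1..<Suc n])"

text \<open>The level \<open>m\<close> is recovered as the length of any string in the tuple;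
  \<open>n > 0\<close> guarantees that there is one.\<close>

lemma prefix_code_eq_iff:
  assumes "n > 0"
  shows "prefix_code n p m = prefix_code n q m' \<longleftrightarrow>
    m = m' \<and> (\<forall>i\<in>{1..n}. \<forall>l<m. p i l = q i l)"
proof -
  have "prefix_code n p m = prefix_code n q m' \<longleftrightarrow>
    (\<forall>i\<in>{1..n}. map (p i) [0..<m] = map (q i) [0..<m'])"
    by (auto simp: prefix_code_def map_eq_conv atLeastLessThanSuc_atLeastAtMost simp del: upt_Suc)
  also have "\<dots> \<longleftrightarrow> (\<forall>i\<in>{1..n}. m = m' \<and> (\<forall>l<m. p i l = q i l))"
  proof (rule ball_cong[OF refl])
    fix i
    have "m = m'" if "map (p i) [0..<m] = map (q i) [0..<m']"
      using arg_cong[OF that, of length] by simp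
    then show "map (p i) [0..<m] = map (q i) [0..<m'] \<longleftrightarrow> m = m' \<and> (\<forall>l<m. p i l = q i l)"
      by auto
  qed
  also have "\<dots> \<longleftrightarrow> m = m' \<and> (\<forall>i\<in>{1..n}. \<forall>l<m. p i l = q i l)"
    using assms by (auto dest: bspec[of _ _ n])
  finally show ?thesis .
qed

lemma inj_prefix_code: "n > 0 \<Longrightarrow> inj (prefix_code n p)"
  by (rule injI) (simp add: prefix_code_eq_iff)

text \<open>Two different branches separate at some bit \<open>l\<close> of some coordinate and
  share no node of level above \<open>l\<close>.\<close>

lemma finite_range_prefix_code_Int:
  assumes "n > 0" "p \<in> {1..n} \<rightarrow>\<^sub>E UNIV" "q \<in> {1..n} \<rightarrow>\<^sub>E UNIV" "p \<noteq> q"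
  shows "finite (range (prefix_code n p) \<inter> range (prefix_code n q))"
proof -
  obtain i where i: "i \<in> {1..n}" "p i \<noteq> q i" using assms(2-4) PiE_ext by blast
  then obtain l where l: "p i l \<noteq> q i l" by blast
  have "range (prefix_code n p) \<inter> range (prefix_code n q) \<subseteq> prefix_code n p ` {..l}"
  proof
    fix v assume "v \<in> range (prefix_code n p) \<inter> range (prefix_code n q)"
    then obtain m m' where v: "v = prefix_code n p m" "v = prefix_code n q m'" by blast
    then have "\<forall>l<m. p i l = q i l" using prefix_code_eq_iff[OF assms(1), of p m q m'] i(1) by simp
    then have "m \<le> l" using l not_less by blast
    then show "v \<in> prefix_code n p ` {..l}" using v by simp
  qed
  then show ?thesis using finite_subset by blast
qed

text \<open>The branches of the tuples in \<open>X\<close> are almost disjoint, so one set can have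
  finite intersection with those satisfying \<open>Q\<close> and infinite intersection with the
  rest.\<close>

lemma Martins_Axiom_coding:
  assumes "Martins_Axiom" "n > 0" "X \<subseteq> {1..n} \<rightarrow>\<^sub>E UNIV" "X \<prec> (UNIV :: cantor set)"
  obtains d :: cantor where "\<And>p. p \<in> X \<Longrightarrow> finite {m. d (prefix_code n p m)} \<longleftrightarrow> Q p"
proof -
  let ?R = "\<lambda>p. range (prefix_code n p)"
  obtain D where D: "\<And>a. a \<in> ?R ` {p \<in> X. Q p} \<Longrightarrow> finite (a \<inter> D)"
    "\<And>c. c \<in> ?R ` {p \<in> X. \<not> Q p} \<Longrightarrow> infinite (c \<inter> D)"
  proof (rule Martins_Axiom_almost_disjoint_from[OF assms(1)])
    have small: "?R ` Y \<prec> (UNIV :: cantor set)" if "Y \<subseteq> X" for Y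
      using lesspoll_trans1[OF lepoll_trans[OF image_lepoll subset_imp_lepoll[OF that]] assms(4)] .
    show "?R ` {p \<in> X. Q p} \<prec> (UNIV :: cantor set)" "?R ` {p \<in> X. \<not> Q p} \<prec> (UNIV :: cantor set)"
      by (auto intro!: small)
    fix c \<F> assume c: "c \<in> ?R ` {p \<in> X. \<not> Q p}" and \<F>: "finite \<F>" "\<F> \<subseteq> ?R ` {p \<in> X. Q p}"
    obtain p where p: "p \<in> X" "\<not> Q p" "c = ?R p" using c by blast
    have "finite (c \<inter> a)" if a: "a \<in> \<F>" for a
    proof -
      obtain q where "q \<in> X" "Q q" "a = ?R q" using \<F>(2) a by blast
      moreover from this have "p \<noteq> q" using p by blast
      ultimately show ?thesis
        unfolding p(3) using p(1) assms(2,3) finite_range_prefix_code_Int by blast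
    qed
    moreover have "infinite c" using p(3) inj_prefix_code[OF assms(2)] range_inj_infinite by blast
    ultimately show "infinite (c - \<Union>\<F>)" using \<F>(1) by (intro infinite_Diff_Union)
  qed blast
  show ?thesis
  proof (rule that[of "\<lambda>v. v \<in> D"])
    fix p assume "p \<in> X"
    \<comment> \<open>Injectivity of the code along a branch lets one count levels \<open>m\<close>
      instead of nodes.\<close>
    have "?R p \<inter> D = prefix_code n p ` {m. prefix_code n p m \<in> D}" by blast
    then have "finite {m. prefix_code n p m \<in> D} \<longleftrightarrow> finite (?R p \<inter> D)"
      using inj_prefix_code[OF assms(2), of p] by (metis finite_image_iff inj_on_subset subset_UNIV)
    then show "finite {m. prefix_code n p m \<in> D} \<longleftrightarrow> Q p" using D \<open>p \<in> X\<close> by (cases "Q p") auto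
  qed
qed

section \<open>The universal function\<close>

definition slice :: "nat \<Rightarrow> cantor \<Rightarrow> cantor" where
  "slice k z l = z (prod_encode (k, l))"

definition join :: "(nat \<Rightarrow> cantor) \<Rightarrow> cantor" where
  "join s t = case_prod s (prod_decode t)"

lemma slice_join [simp]: "slice k (join s) = s k"
  by (simp add: slice_def join_def fun_eq_iff)

text \<open>
  In a value \<open>h \<alpha>\<close>, slice \<open>0\<close> is \<open>\<alpha>\<close>, slice \<open>1\<close> is the region below \<open>f\<^sub>\<alpha>\<close>, and slice \<open>k + 2\<close> is the
  coding set for bit \<open>k\<close> of the output.
\<close>

definition mismatch :: "nat \<Rightarrow> nat \<Rightarrow> nat \<Rightarrow> (nat \<Rightarrow> cantor) \<Rightarrow> nat \<Rightarrow> bool" where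
  "mismatch n i k x m \<longleftrightarrow> (\<exists>j\<in>{1..n}. slice 1 (x j) m \<and> \<not> slice 1 (x i) m)
     \<or> slice (k + 2) (x i) (prefix_code n (\<lambda>j. slice 0 (x j)) m)"

text \<open>The index \<open>i\<close> guesses a largest coordinate. A wrong guess is meant to fail
  through infinitely many failures of inclusion, a right one to be decided by its coding set; both
  tests share one finiteness condition.\<close>

definition universal_map :: "nat \<Rightarrow> (nat \<Rightarrow> cantor) \<Rightarrow> cantor" where
  "universal_map n x k \<longleftrightarrow> (\<exists>i\<in>{1..n}. finite {m. mismatch n i k x m})"

section \<open>Topological complexity of the evaluation\<close>

lemma openin_cantor_power_finitely_determined:
  assumes "\<And>x. x \<in> topspace (cantor_power n) \<Longrightarrow> Q x \<Longrightarrow>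
    \<exists>M. \<forall>y\<in>topspace (cantor_power n). (\<forall>j\<in>{1..n}. \<forall>l<M. y j l = x j l) \<longrightarrow> Q y"
  shows "openin (cantor_power n) {x \<in> topspace (cantor_power n). Q x}"
proof (subst openin_subopen, clarify)
  fix x assume x: "x \<in> topspace (cantor_power n)" "Q x"
  from assms[OF this] obtain M where M: "\<forall>y\<in>topspace (cantor_power n).
      (\<forall>j\<in>{1..n}. \<forall>l<M. y j l = x j l) \<longrightarrow> Q y" by (rule exE)
  let ?W = "\<lambda>j. \<Inter>l<M. {z. z l = x j l} :: cantor set"
  have "open {z :: cantor. z l = b}" for l b
  proof -
    have "open ((\<lambda>z :: cantor. z l) -` {b})"
      by (rule open_vimage[OF open_discrete continuous_on_product_coordinates])
    then show ?thesis by (simp add: vimage_def)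
  qed
  then have "open (?W j)" for j by (intro open_INT) auto
  then have "openin (cantor_power n) (Pi\<^sub>E {1..n} ?W)"
    unfolding cantor_power_def
    by (intro iffD2[OF openin_PiE] disjI2 ballI) (simp_all flip: open_openin)
  moreover have "x \<in> Pi\<^sub>E {1..n} ?W" using x(1) by (auto simp: topspace_cantor_power)
  moreover have "Pi\<^sub>E {1..n} ?W \<subseteq> {x \<in> topspace (cantor_power n). Q x}"
  proof
    fix y assume y: "y \<in> Pi\<^sub>E {1..n} ?W"
    then have "y \<in> topspace (cantor_power n)" by (auto simp: topspace_cantor_power PiE_iff)
    moreover have "\<forall>j\<in>{1..n}. \<forall>l<M. y j l = x j l" using y by (auto simp: PiE_iff)
    ultimately show "y \<in> {x \<in> topspace (cantor_power n). Q x}" using M by blast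
  qed
  ultimately show "\<exists>T. openin (cantor_power n) T \<and> x \<in> T \<and> T \<subseteq> {x \<in> topspace (cantor_power n). Q x}"
    by blast
qed

text \<open>Only finitely many bits are consulted: bit \<open>m\<close> of each slice 1, the first
  \<open>m\<close> bits of each slice 0, and one bit of slice \<open>k + 2\<close> of coordinate
  \<open>i\<close>.\<close>

lemma openin_mismatch:
  assumes "n > 0" "i \<in> {1..n}"
  shows "openin (cantor_power n) {x \<in> topspace (cantor_power n). mismatch n i k x m}"
proof (rule openin_cantor_power_finitely_determined)
  fix x :: "nat \<Rightarrow> cantor" assume Q: "mismatch n i k x m"
  let ?v = "prefix_code n (\<lambda>j. slice 0 (x j)) m"
  let ?S = "insert (prod_encode (1, m))
    (insert (prod_encode (k + 2, ?v)) ((\<lambda>l. prod_encode (0, l)) ` {..<m}))"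
  obtain M where M: "\<And>t. t \<in> ?S \<Longrightarrow> t < M"
    using finite_nat_set_iff_bounded[of ?S] by auto
  show "\<exists>M. \<forall>y\<in>topspace (cantor_power n). (\<forall>j\<in>{1..n}. \<forall>l<M. y j l = x j l) \<longrightarrow> mismatch n i k y m"
  proof (intro exI[of _ M] ballI impI)
    fix y :: "nat \<Rightarrow> cantor" assume eq: "\<forall>j\<in>{1..n}. \<forall>l<M. y j l = x j l"
    \<comment> \<open>The position consulted in slice \<open>k + 2\<close> itself depends on the
      point; agreement on these prefixes makes it \<open>?v\<close> for \<open>y\<close>
      too.\<close>
    have 0: "slice 0 (y j) l = slice 0 (x j) l" if "j \<in> {1..n}" "l < m" for j l
      using eq M that unfolding slice_def by blast
    then have "prefix_code n (\<lambda>j. slice 0 (y j)) m = ?v"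
      using prefix_code_eq_iff[OF assms(1)] by simp
    moreover have "slice 1 (y j) m = slice 1 (x j) m" if "j \<in> {1..n}" for j
      using eq M that unfolding slice_def by blast
    moreover have "slice (k + 2) (y i) ?v = slice (k + 2) (x i) ?v"
      using eq M assms(2) unfolding slice_def by blast
    ultimately show "mismatch n i k y m" using Q assms(2) unfolding mismatch_def by auto
  qed
qed

text \<open>Finiteness means that \<open>P x\<close> fails from some \<open>N\<close> on, and for
  each \<open>N\<close> this is a closed condition on \<open>x\<close>.\<close>

lemma fsigma_in_finite_Collect:
  assumes "\<And>m :: nat. openin X {x \<in> topspace X. P x m}"
  shows "fsigma_in X {x \<in> topspace X. finite {m. P x m}}"
proof -
  let ?C = "\<lambda>N. topspace X - (\<Union>m\<in>{N..}. {x \<in> topspace X. P x m})"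
  have "finite {m. P x m} \<longleftrightarrow> (\<exists>N. \<forall>m\<ge>N. \<not> P x m)" for x
    unfolding finite_nat_set_iff_bounded by (meson linorder_not_le mem_Collect_eq)
  then have "{x \<in> topspace X. finite {m. P x m}} = (\<Union>N. ?C N)" by auto
  moreover have "closedin X (?C N)" for N
    using assms by (intro closedin_diff openin_Union) auto
  then have "fsigma_in X (\<Union>N. ?C N)"
    by (intro fsigma_in_Union) (auto intro: closed_imp_fsigma_in)
  ultimately show ?thesis by simp
qed

lemma level2_universal_map:
  assumes "n > 0"
  shows "level2 n (universal_map n)"
  unfolding level2_def
proof
  fix k
  let ?X = "cantor_power n"
  have "{x \<in> topspace ?X. universal_map n x k} =
      (\<Union>i\<in>{1..n}. {x \<in> topspace ?X. finite {m. mismatch n i k x m}})"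
    by (auto simp: universal_map_def)
  moreover have "fsigma_in ?X (\<Union>i\<in>{1..n}. {x \<in> topspace ?X. finite {m. mismatch n i k x m}})"
    by (rule fsigma_in_Union) (auto intro!: fsigma_in_finite_Collect openin_mismatch assms)
  ultimately show "fsigma_in ?X {x \<in> topspace ?X. universal_map n x k}" by simp
qed

section \<open>Universality\<close>

lemma linear_order_finite_has_greatest:
  assumes "linear_order_on UNIV r" "finite A" "A \<noteq> {}"
  shows "\<exists>a\<in>A. \<forall>b\<in>A. (b, a) \<in> r"
proof -
  have refl: "(x, x) \<in> r" and total: "x = y \<or> (x, y) \<in> r \<or> (y, x) \<in> r"
    and trans: "(x, y) \<in> r \<Longrightarrow> (y, z) \<in> r \<Longrightarrow> (x, z) \<in> r" for x y z
    using assms(1) by (auto simp: order_on_defs refl_on_def total_on_def dest: transD)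
  show ?thesis
    using assms(2,3)
  proof (induction A rule: finite_ne_induct)
    case (singleton x)
    then show ?case using refl by simp
  next
    case (insert x A)
    then obtain a where a: "a \<in> A" "\<forall>b\<in>A. (b, a) \<in> r" by blast
    show ?case
    proof (cases "(x, a) \<in> r")
      case True
      then show ?thesis using a by blast
    next
      case False
      then have "(a, x) \<in> r" using total[of a x] refl by auto
      then show ?thesis using a refl trans by blast
    qed
  qed
qed

lemma universal_universal_map:
  assumes "Martins_Axiom" "n > 0"
  shows "universal n (universal_map n)"
  unfolding universal_def
proof
  fix G :: "(nat \<Rightarrow> cantor) \<Rightarrow> cantor"
  let ?X = "topspace (cantor_power n)"
  obtain r :: "cantor rel" where r: "well_order_on UNIV r" and
    small: "\<And>a. underS r a \<prec> (UNIV :: cantor set)"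
    using exists_small_initial_segments by blast
  obtain T :: "cantor \<Rightarrow> cantor" where T: "\<And>a b. finite {m. T b m \<and> \<not> T a m} \<longleftrightarrow> (b, a) \<in> r"
    using Martins_Axiom_tower[OF assms(1) r small] by blast
  \<comment> \<open>The set for \<open>a\<close> has to code \<open>G\<close> only on tuples with
    all entries at most \<open>a\<close>, of which there are fewer than continuum many.\<close>
  have "\<exists>d :: cantor. \<forall>p\<in>{1..n} \<rightarrow>\<^sub>E under r a. finite {m. d (prefix_code n p m)} \<longleftrightarrow> G p k" for a k
  proof -
    have "under r a \<subseteq> underS r a \<union> {a}" by (auto simp: under_def underS_def)
    moreover have "underS r a \<union> {a} \<prec> (UNIV :: cantor set)"
      by (intro lesspoll_Un_infinite infinite_cantor small finite_lesspoll_infinite) simp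
    ultimately have "under r a \<prec> (UNIV :: cantor set)"
      using subset_imp_lepoll lesspoll_trans1 by blast
    then have "({1..n} \<rightarrow>\<^sub>E under r a) \<prec> (UNIV :: cantor set)"
      by (intro lesspoll_PiE infinite_cantor) auto
    moreover have "({1..n} \<rightarrow>\<^sub>E under r a) \<subseteq> ({1..n} \<rightarrow>\<^sub>E UNIV)" by (rule PiE_mono) auto
    ultimately show ?thesis
      using Martins_Axiom_coding[OF assms, of "{1..n} \<rightarrow>\<^sub>E under r a" "\<lambda>p. G p k"] by metis
  qed
  then obtain d :: "cantor \<Rightarrow> nat \<Rightarrow> cantor" where d: "\<And>a k p. p \<in> {1..n} \<rightarrow>\<^sub>E under r a \<Longrightarrow>
      finite {m. d a k (prefix_code n p m)} \<longleftrightarrow> G p k"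
    by metis
  define h where "h = (\<lambda>a. join (\<lambda>s. if s = 0 then a else if s = 1 then T a else d a (s - 2)))"
  have h: "slice 0 (h a) = a" "slice 1 (h a) = T a" "slice (k + 2) (h a) = d a k" for a k
    by (simp_all add: h_def)
  have "G x = universal_map n (\<lambda>i\<in>{1..n}. h (x i))" if x: "x \<in> ?X" for x
  proof
    fix k
    let ?y = "\<lambda>i\<in>{1..n}. h (x i)"
    \<comment> \<open>Slice 0 of \<open>h (x j)\<close> returns \<open>x j\<close>, so the
      evaluation looks up the branch of the original tuple.\<close>
    have code: "prefix_code n (\<lambda>j. slice 0 (?y j)) m = prefix_code n x m" for m
      using prefix_code_eq_iff[OF assms(2)] by (simp add: h)
    have mismatch: "{m. mismatch n i k ?y m} =
        (\<Union>j\<in>{1..n}. {m. T (x j) m \<and> \<not> T (x i) m}) \<union> {m. d (x i) k (prefix_code n x m)}"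
      if "i \<in> {1..n}" for i
      unfolding mismatch_def code using that by (auto simp: h h(2)[unfolded One_nat_def] h(3)[simplified])
    \<comment> \<open>For a largest \<open>x i\<close> the inclusions contribute finitely many
      mismatches and the coding set decides. For any other \<open>i\<close> some inclusion fails
      infinitely often, whatever \<open>d (x i) k\<close> does on this tuple.\<close>
    have *: "finite {m. mismatch n i k ?y m} \<longleftrightarrow> (\<forall>j\<in>{1..n}. (x j, x i) \<in> r) \<and> G x k"
      if i: "i \<in> {1..n}" for i
    proof (cases "\<forall>j\<in>{1..n}. (x j, x i) \<in> r")
      case True
      then have "x \<in> {1..n} \<rightarrow>\<^sub>E under r (x i)"
        using x by (auto simp: topspace_cantor_power under_def PiE_iff)
      then have "finite {m. d (x i) k (prefix_code n x m)} \<longleftrightarrow> G x k" by (rule d)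
      then show ?thesis unfolding mismatch[OF i] finite_Un finite_UN[OF finite_atLeastAtMost] T
        using True by blast
    next
      case False
      then show ?thesis
        unfolding mismatch[OF i] finite_Un finite_UN[OF finite_atLeastAtMost] T by blast
    qed
    have "\<exists>a\<in>x ` {1..n}. \<forall>b\<in>x ` {1..n}. (b, a) \<in> r"
      using r assms(2) by (intro linear_order_finite_has_greatest) (auto simp: well_order_on_def)
    then show "G x k = universal_map n ?y k"
      unfolding universal_map_def using * by auto
  qed
  then show "\<exists>h. \<forall>x\<in>?X. G x = universal_map n (\<lambda>i\<in>{1..n}. h i (x i))"
    by (intro exI[of _ "\<lambda>_. h"]) simp
qed

theorem proposition6p15:
  assumes "Martins_Axiom"
  shows "\<forall>n>1. \<exists>F. borel_function n F \<and> level2 n F \<and> universal n F"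
proof (intro allI impI exI conjI)
  fix n :: nat assume "n > 1"
  then show "level2 n (universal_map n)" "universal n (universal_map n)"
    using level2_universal_map universal_universal_map[OF assms] by auto
  then show "borel_function n (universal_map n)" by (intro level2_imp_borel_function)
qed

end
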